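(* Fix $\beta>0$. For every $\eta\in(0,1)$ there exist a unique value $\lambda(\eta)$ of the exogenous flow rate $\lambda$ and a unique probability measure $\mu_\eta$ on the set of queue states such that, with $\lambda=\lambda(\eta)$ and $\mu=\mu_\eta$, the following system holds together with the condition $\eta(\mu_\eta)=\eta$: (i) the rates $\nu_k=\nu_k(\mu)$ satisfy the symmetry $\nu_k=\nu_{-k}$ for all $k\in\mathbb{Z}$; (ii) for every $l\ge0$ and every $(n_1,\dots,n_l)\in\mathbb{Z}^l$, $$\mu(n_1,\dots,n_{l-1})\left[\nu_{n_l}(\mu)+\lambda\delta(n_l,0)\right]-\mu(n_1,\dots,n_l)\Big(\sum_{k\ne0}\nu_k(\mu)+\lambda\Big)+\sum_{k}\mu(k,n_1,\dots,n_l)-\mu(n_1,\dots,n_l)\mathbb{I}_{l\ne0}$$ $$+\beta\left[\mu(n_1+1,\dots,n_l+1)+\mu(n_1-1,\dots,n_l-1)-2\mu(n_1,\dots,n_l)\right]=0.$$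
   Context: A queue state is a finite sequence $(n_1,\dots,n_l)$, $l\ge0$, of integers (the signed distances from the server's position to the destinations of its customers, in FIFO order). For a probability measure $\mu$ on the countable set of queue states, define $$\nu_k(\mu)=\begin{cases}\sum_{\mathcal N}\mu(k+1,\mathcal N)&k>0,\\ \sum_{\mathcal N}\mu(k-1,\mathcal N)&k<0,\\ 0&k=0,\end{cases}$$ where $\mathcal N$ runs over all finite integer sequences and $(m,\mathcal N)$ denotes the sequence with first element $m$ followed by $\mathcal N$. Set $\nu(\mu)=\sum_{k\ne0}\nu_k(\mu)$ and $\eta(\mu)=\nu(\mu)+\lambda$ (the total flow rate to every node, $\lambda$ being the exogenous flow rate). $\delta(\cdot,\cdot)$ is the Kronecker delta. For $l=0$ the first term in the equation of (ii) is absent (and the bracket multiplied by $\beta$ is zero). *)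

theory Defs
  imports "HOL-Probability.Probability"
begin

type_synonym queue = "int list"

text \<open>All infinite sums below have nonnegative terms and are bounded by the total mass 1 of
  the measure, so they converge and the default value 0 of \<^const>\<open>infsum\<close> plays no role.\<close>

definition node_rate :: "queue pmf \<Rightarrow> int \<Rightarrow> real" where
  "node_rate \<mu> k =
     (if k > 0 then (\<Sum>\<^sub>\<infinity>N. pmf \<mu> ((k + 1) # N))
      else if k < 0 then (\<Sum>\<^sub>\<infinity>N. pmf \<mu> ((k - 1) # N))
      else 0)"

definition transit_rate :: "queue pmf \<Rightarrow> real" where
  "transit_rate \<mu> = (\<Sum>\<^sub>\<infinity>k\<in>- {0}. node_rate \<mu> k)"

definition total_rate :: "real \<Rightarrow> queue pmf \<Rightarrow> real" where
  "total_rate lam \<mu> = transit_rate \<mu> + lam"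

definition symmetric_rates :: "queue pmf \<Rightarrow> bool" where
  "symmetric_rates \<mu> \<longleftrightarrow> (\<forall>k. node_rate \<mu> k = node_rate \<mu> (- k))"

definition balance :: "real \<Rightarrow> real \<Rightarrow> queue pmf \<Rightarrow> bool" where
  "balance \<beta> lam \<mu> \<longleftrightarrow> (\<forall>ns.
     (if ns = [] then 0
      else pmf \<mu> (butlast ns) * (node_rate \<mu> (last ns) + lam * of_bool (last ns = 0)))
     - pmf \<mu> ns * (transit_rate \<mu> + lam)
     + (\<Sum>\<^sub>\<infinity>k. pmf \<mu> (k # ns))
     - pmf \<mu> ns * of_bool (ns \<noteq> [])
     + \<beta> * (pmf \<mu> (map (\<lambda>n. n + 1) ns) + pmf \<mu> (map (\<lambda>n. n - 1) ns) - 2 * pmf \<mu> ns)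
     = 0)"

end

theory Submission
  imports Defs
begin

text \<open>The queue length is that of an M/M/1 queue with load \<open>\<eta>\<close>, and for given arrival rates the
  stationary law of the queue is unique and explicit: the stationary queue is built up from its
  customers' arrival times. Its head has a law \<open>d\<close> with \<open>(1 - \<eta> - \<beta> \<Delta>) d = (1 - \<eta>) a\<close>, where \<open>a\<close> are the
  arrival rates. Self-consistency means \<open>a k = d (k + 1)\<close> for \<open>k > 0\<close> and \<open>a k = d (k - 1)\<close> for \<open>k < 0\<close>,
  which turns this relation into a linear recurrence whose only summable solution of mass \<open>\<eta>\<close> is a
  symmetric two-sided geometric sequence. So \<open>d\<close>, hence \<open>a\<close>, hence \<open>\<lambda>\<close> and the measure, are
  determined.\<close>

section \<open>Point masses, pushforwards and infinite sums\<close>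

lemma has_sum_pmf: "(pmf M has_sum measure_pmf.prob M S) S"
proof -
  have "infsum (pmf M) S = measure_pmf.prob M S"
    using infsetsum_infsum[of "pmf M" S] by (simp add: measure_pmf_conv_infsetsum pmf_abs_summable)
  moreover have "pmf M summable_on S"
    by (metis summable_on_iff_abs_summable_on_real abs_summable_equivalent pmf_abs_summable)
  ultimately show ?thesis
    by (metis has_sum_infsum)
qed

lemma embed_pmf_has_sum:
  fixes f :: "'a \<Rightarrow> real"
  assumes "(f has_sum s) UNIV" and "\<And>x. 0 \<le> f x" and "s > 0"
  shows "pmf (embed_pmf (\<lambda>x. f x / s)) x = f x / s"
proof (rule pmf_embed_pmf)
  have *: "((\<lambda>x. f x / s) has_sum 1) UNIV"
    using has_sum_cmult_right[OF assms(1), of "1 / s"] assms(3) by simp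
  then have abs: "Infinite_Set_Sum.abs_summable_on (\<lambda>x. f x / s) UNIV"
    by (metis summable_on_iff_abs_summable_on_real abs_summable_equivalent summable_on_def)
  have "infsetsum (\<lambda>x. f x / s) UNIV = 1"
    using infsetsum_infsum[OF abs] * by (simp add: infsumI)
  with nn_integral_conv_infsetsum[OF abs]
  show "(\<integral>\<^sup>+ x. ennreal (f x / s) \<partial>count_space UNIV) = 1"
    using assms by simp
qed (use assms in auto)

text \<open>An arrival with independent destination, written as a law so that the total mass of the
  arrival term of the balance can be read off.\<close>

definition snoc_pmf :: "'a list pmf \<Rightarrow> 'a pmf \<Rightarrow> 'a list pmf" where
  "snoc_pmf M A = map_pmf (\<lambda>(N, x). N @ [x]) (pair_pmf M A)"

abbreviation translate :: "int \<Rightarrow> queue \<Rightarrow> queue" where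
  "translate j \<equiv> map (\<lambda>n. n + j)"

lemma pmf_snoc_Nil [simp]: "pmf (snoc_pmf M A) [] = 0"
  unfolding snoc_pmf_def by (rule pmf_map_outside) auto

lemma pmf_snoc [simp]: "pmf (snoc_pmf M A) (N @ [x]) = pmf M N * pmf A x"
proof -
  have "inj (\<lambda>(N, x). N @ [x])"
    by (auto simp: inj_on_def)
  from pmf_map_inj'[OF this, of "pair_pmf M A" "(N, x)"] show ?thesis
    by (simp add: snoc_pmf_def pmf_pair)
qed

lemma pmf_snoc_conv:
  "pmf (snoc_pmf M A) ns = (if ns = [] then 0 else pmf M (butlast ns) * pmf A (last ns))"
  by (cases ns rule: rev_cases) auto

lemma pmf_translate: "pmf (map_pmf (translate j) M) ns = pmf M (translate (-j) ns)"
proof -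
  have "inj (translate j)"
    by (simp add: inj_on_def)
  from pmf_map_inj'[OF this, of M "translate (-j) ns"] show ?thesis
    by (simp add: o_def)
qed

lemma has_sum_pmf_Cons:
  "((\<lambda>k. pmf M (k # ns)) has_sum measure_pmf.prob M {N. N \<noteq> [] \<and> tl N = ns}) UNIV"
proof -
  have "bij_betw (\<lambda>k. k # ns) UNIV {N. N \<noteq> [] \<and> tl N = ns}"
    by (rule bij_betw_byWitness[where f' = hd]) auto
  from has_sum_reindex_bij_betw[OF this, of "pmf M"] show ?thesis
    using has_sum_pmf by blast
qed

text \<open>The last summand arises from \<open>tl [] = []\<close>: the empty queue lies in the
  fibre over itself.\<close>

lemma pmf_map_tl:
  "pmf (map_pmf tl M) ns = (\<Sum>\<^sub>\<infinity>k. pmf M (k # ns)) + pmf M [] * of_bool (ns = [])"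
proof -
  have eq: "tl -` {ns} = {N. N \<noteq> [] \<and> tl N = ns} \<union> (if ns = [] then {[]} else {})"
    by auto
  have "pmf (map_pmf tl M) ns = measure_pmf.prob M (tl -` {ns})"
    by (simp add: pmf_map)
  also have "\<dots> = measure_pmf.prob M {N. N \<noteq> [] \<and> tl N = ns}
      + measure_pmf.prob M (if ns = [] then {[]} else {})"
    unfolding eq by (rule measure_pmf.finite_measure_Union) auto
  finally show ?thesis
    by (auto simp: infsumI[OF has_sum_pmf_Cons] measure_pmf_single)
qed

lemma has_sum_pmf_hd:
  "((\<lambda>N. pmf M (k # N)) has_sum measure_pmf.prob M {N. N \<noteq> [] \<and> hd N = k}) UNIV"
proof -
  have "bij_betw (\<lambda>N. k # N) UNIV {N. N \<noteq> [] \<and> hd N = k}"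
    by (rule bij_betw_byWitness[where f' = tl]) auto
  from has_sum_reindex_bij_betw[OF this, of "pmf M"] show ?thesis
    using has_sum_pmf by blast
qed

section \<open>Head of the queue, and the balance equation for frozen arrival rates\<close>

definition head_prob :: "queue pmf \<Rightarrow> int \<Rightarrow> real" where
  "head_prob \<mu> k = measure_pmf.prob \<mu> {N. N \<noteq> [] \<and> hd N = k}"

lemma head_prob_nonneg: "head_prob \<mu> k \<ge> 0"
  by (simp add: head_prob_def)

lemma has_sum_head_prob: "(head_prob \<mu> has_sum (1 - pmf \<mu> [])) UNIV"
proof -
  have "(pmf \<mu> has_sum measure_pmf.prob \<mu> (- {[]})) (- {[]})"
    by (rule has_sum_pmf)
  also have "measure_pmf.prob \<mu> (- {[]}) = 1 - pmf \<mu> []"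
    using measure_pmf.prob_compl[of "{[]}" \<mu>] by (simp add: Compl_eq_Diff_UNIV measure_pmf_single)
  finally have *: "(pmf \<mu> has_sum (1 - pmf \<mu> [])) (- {[]})" .
  \<comment> \<open>Non-empty queues are pairs of a head and a tail; summing over the tail first
    gives \<open>head_prob\<close>.\<close>
  have "bij_betw (\<lambda>(k, N). k # N) (UNIV \<times> UNIV) (- {[]})"
    by (rule bij_betw_byWitness[where f' = "\<lambda>N. (hd N, tl N)"]) auto
  from has_sum_reindex_bij_betw[OF this, of "pmf \<mu>"] *
  have "((\<lambda>(k, N). pmf \<mu> (k # N)) has_sum (1 - pmf \<mu> [])) (UNIV \<times> UNIV)"
    by (simp add: case_prod_unfold)
  from has_sum_SigmaD[OF this, of "head_prob \<mu>"] show ?thesis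
    by (simp add: head_prob_def has_sum_pmf_hd)
qed

lemma node_rate_conv:
  "node_rate \<mu> k = (if k > 0 then head_prob \<mu> (k + 1) else if k < 0 then head_prob \<mu> (k - 1) else 0)"
  by (simp add: node_rate_def head_prob_def infsumI[OF has_sum_pmf_hd])

text \<open>The balance equation with the arrival rates frozen at \<open>\<eta>\<close> times \<open>A\<close>. As \<open>tl [] = []\<close>, a service
  at the empty queue is a void jump, which removes the indicator of \<open>l \<noteq> 0\<close>.\<close>

definition stationary :: "real \<Rightarrow> real \<Rightarrow> int pmf \<Rightarrow> queue pmf \<Rightarrow> bool" where
  "stationary \<beta> \<eta> A \<mu> \<longleftrightarrow> (\<forall>ns. (\<eta> + 1 + 2 * \<beta>) * pmf \<mu> ns =
     \<eta> * pmf (snoc_pmf \<mu> A) ns + pmf (map_pmf tl \<mu>) ns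
     + \<beta> * pmf (map_pmf (translate 1) \<mu>) ns + \<beta> * pmf (map_pmf (translate (-1)) \<mu>) ns)"

text \<open>The outflow, moved to the left, has total rate \<open>\<eta> + 1 + 2 * \<beta>\<close>.
  At the empty queue the void service adds \<open>pmf \<mu> []\<close> to both sides, which accounts
  for the indicator.\<close>

lemma balance_iff_stationary:
  assumes "total_rate lam \<mu> = \<eta>"
    and "\<And>k. node_rate \<mu> k + lam * of_bool (k = 0) = \<eta> * pmf A k"
  shows "balance \<beta> lam \<mu> \<longleftrightarrow> stationary \<beta> \<eta> A \<mu>"
proof -
  have eta: "transit_rate \<mu> + lam = \<eta>"
    using assms(1) by (simp add: total_rate_def)
  show ?thesis
    unfolding balance_def stationary_def eta assms(2) pmf_translate pmf_snoc_conv pmf_map_tl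
    by (intro all_cong1) (auto simp: algebra_simps)
qed

section \<open>Queue length and uniqueness of the stationary law\<close>

lemma has_sum_stationary_rhs:
  "((\<lambda>ns. \<eta> * pmf (snoc_pmf \<mu> A) ns + pmf (map_pmf tl \<mu>) ns
     + \<beta> * pmf (map_pmf (translate 1) \<mu>) ns + \<beta> * pmf (map_pmf (translate (-1)) \<mu>) ns) has_sum
    (\<eta> * measure_pmf.prob (snoc_pmf \<mu> A) S + measure_pmf.prob (map_pmf tl \<mu>) S
     + \<beta> * measure_pmf.prob (map_pmf (translate 1) \<mu>) S
     + \<beta> * measure_pmf.prob (map_pmf (translate (-1)) \<mu>) S)) S"
  by (intro has_sum_add has_sum_cmult_right has_sum_pmf)

lemma stationary_prob:
  assumes "stationary \<beta> \<eta> A \<mu>"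
  shows "(\<eta> + 1 + 2 * \<beta>) * measure_pmf.prob \<mu> S =
    \<eta> * measure_pmf.prob (snoc_pmf \<mu> A) S + measure_pmf.prob \<mu> (tl -` S)
    + \<beta> * measure_pmf.prob \<mu> (translate 1 -` S) + \<beta> * measure_pmf.prob \<mu> (translate (-1) -` S)"
proof -
  have "((\<lambda>ns. (\<eta> + 1 + 2 * \<beta>) * pmf \<mu> ns) has_sum (\<eta> + 1 + 2 * \<beta>) * measure_pmf.prob \<mu> S) S"
    by (intro has_sum_cmult_right has_sum_pmf)
  then have "(\<eta> + 1 + 2 * \<beta>) * measure_pmf.prob \<mu> S =
    \<eta> * measure_pmf.prob (snoc_pmf \<mu> A) S + measure_pmf.prob (map_pmf tl \<mu>) S
     + \<beta> * measure_pmf.prob (map_pmf (translate 1) \<mu>) S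
     + \<beta> * measure_pmf.prob (map_pmf (translate (-1)) \<mu>) S"
    using has_sum_stationary_rhs[of \<eta> \<mu> A \<beta> S] assms has_sum_unique
    unfolding stationary_def by simp
  then show ?thesis
    by simp
qed

text \<open>Both sides have total mass \<open>\<eta> + 1 + 2 * \<beta>\<close>, so their nonnegative
  difference sums to 0 and vanishes pointwise.\<close>

lemma substationary_imp_stationary:
  assumes "\<And>ns. (\<eta> + 1 + 2 * \<beta>) * pmf \<mu> ns \<le>
     \<eta> * pmf (snoc_pmf \<mu> A) ns + pmf (map_pmf tl \<mu>) ns
     + \<beta> * pmf (map_pmf (translate 1) \<mu>) ns + \<beta> * pmf (map_pmf (translate (-1)) \<mu>) ns"
  shows "stationary \<beta> \<eta> A \<mu>"
  unfolding stationary_def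
proof
  fix ns
  define g where "g ns = \<eta> * pmf (snoc_pmf \<mu> A) ns + pmf (map_pmf tl \<mu>) ns
     + \<beta> * pmf (map_pmf (translate 1) \<mu>) ns + \<beta> * pmf (map_pmf (translate (-1)) \<mu>) ns" for ns
  have g: "(g has_sum (\<eta> + 1 + 2 * \<beta>)) UNIV"
    using has_sum_stationary_rhs[of \<eta> \<mu> A \<beta> UNIV] measure_pmf.prob_space
    by (simp add: g_def[abs_def] add_ac)
  have f: "((\<lambda>ns. (\<eta> + 1 + 2 * \<beta>) * pmf \<mu> ns) has_sum (\<eta> + 1 + 2 * \<beta>)) UNIV"
    using has_sum_cmult_right[OF has_sum_pmf[of \<mu> UNIV], of "\<eta> + 1 + 2 * \<beta>"] by simp
  have "((\<lambda>ns. g ns - (\<eta> + 1 + 2 * \<beta>) * pmf \<mu> ns) has_sum 0) UNIV"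
    using has_sum_add[OF g has_sum_cmult_right[OF f, of "-1"]] by simp
  then have "g ns - (\<eta> + 1 + 2 * \<beta>) * pmf \<mu> ns = 0"
    by (rule nonneg_has_sum_le_0D) (use assms in \<open>auto simp: g_def\<close>)
  then show "(\<eta> + 1 + 2 * \<beta>) * pmf \<mu> ns = \<eta> * pmf (snoc_pmf \<mu> A) ns + pmf (map_pmf tl \<mu>) ns
     + \<beta> * pmf (map_pmf (translate 1) \<mu>) ns + \<beta> * pmf (map_pmf (translate (-1)) \<mu>) ns"
    by (simp add: g_def)
qed

lemma prob_snoc_length:
  "measure_pmf.prob (snoc_pmf \<mu> A) {ns. length ns > i} = measure_pmf.prob \<mu> {ns. length ns \<ge> i}"
proof -
  have "map_pmf length (snoc_pmf \<mu> A) = map_pmf (Suc \<circ> length) (map_pmf fst (pair_pmf \<mu> A))"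
    unfolding snoc_pmf_def pmf.map_comp by (rule map_pmf_cong) auto
  then have "map_pmf length (snoc_pmf \<mu> A) = map_pmf (Suc \<circ> length) \<mu>"
    by (simp only: map_fst_pair_pmf)
  then have "measure_pmf.prob (map_pmf length (snoc_pmf \<mu> A)) {i<..}
      = measure_pmf.prob (map_pmf (Suc \<circ> length) \<mu>) {i<..}"
    by simp
  then show ?thesis
    by (simp add: vimage_def less_Suc_eq_le)
qed

text \<open>Displacements preserve the length, so only arrivals and services matter for it: the
  length is geometric with ratio \<eta>, and normalisation gives its mass at 0.\<close>

lemma stationary_pmf_Nil:
  assumes "stationary \<beta> \<eta> A \<mu>" and "0 \<le> \<eta>" and "\<eta> < 1"
  shows "pmf \<mu> [] = 1 - \<eta>"
proof -
  define p where "p i = measure_pmf.prob \<mu> {ns. length ns = i}" for i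
  define C where "C i = measure_pmf.prob \<mu> {ns. length ns > i}" for i
  have ge: "measure_pmf.prob \<mu> {ns. length ns \<ge> i} = p i + C i" for i
  proof -
    have "{ns :: queue. length ns \<ge> i} = {ns. length ns = i} \<union> {ns. length ns > i}"
      by auto
    moreover have "measure_pmf.prob \<mu> ({ns. length ns = i} \<union> {ns. length ns > i}) = p i + C i"
      unfolding p_def C_def by (rule measure_pmf.finite_measure_Union) auto
    ultimately show ?thesis by simp
  qed
  have C_Suc: "C i = p (Suc i) + C (Suc i)" for i
    using ge[of "Suc i"] by (simp add: C_def Suc_le_eq)
  \<comment> \<open>Cut equation: arrivals carry the flow from length \<open>i\<close> to
    \<open>Suc i\<close>, services carry it back.\<close>
  have "\<eta> * p i = p (Suc i)" for i
  proof -
    have "tl -` {ns :: queue. length ns > i} = {ns. length ns > Suc i}"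
      by auto
    then have "(\<eta> + 1 + 2 * \<beta>) * C i = \<eta> * (p i + C i) + C (Suc i) + \<beta> * C i + \<beta> * C i"
      using stationary_prob[OF assms(1), of "{ns. length ns > i}"]
      unfolding prob_snoc_length ge by (simp add: C_def vimage_def)
    then show ?thesis
      using C_Suc[of i] by (simp add: algebra_simps)
  qed
  then have p_Suc: "p (Suc i) = \<eta> * p i" for i
    by simp
  have p: "p i = p 0 * \<eta> ^ i" for i
    by (induction i) (simp_all add: p_Suc)
  have "pmf (map_pmf length \<mu>) = p"
    by (simp add: fun_eq_iff pmf_map p_def vimage_def)
  then have "(p has_sum 1) UNIV"
    using has_sum_pmf[of "map_pmf length \<mu>" UNIV] by (simp add: measure_pmf.prob_space)
  then have "p sums 1"
    by (rule has_sum_imp_sums)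
  also have "p = (\<lambda>i. p 0 * \<eta> ^ i)"
    by (rule ext) (rule p)
  finally have "(\<lambda>i. p 0 * \<eta> ^ i) sums 1" .
  moreover have "(\<lambda>i. p 0 * \<eta> ^ i) sums (p 0 * (1 / (1 - \<eta>)))"
    using assms by (intro sums_mult geometric_sums) auto
  ultimately have "p 0 * (1 / (1 - \<eta>)) = 1"
    by (metis sums_unique2)
  moreover have "p 0 = pmf \<mu> []"
    by (simp add: p_def measure_pmf_single)
  ultimately show ?thesis
    using assms by (simp add: field_simps)
qed

text \<open>The normalised \<open>\<bar>\<mu> - \<mu>'\<bar>\<close> is substationary, hence stationary, but gives no mass to the empty
  queue, whereas every stationary law gives it \<open>1 - \<eta>\<close>.\<close>

lemma stationary_unique:
  assumes mu: "stationary \<beta> \<eta> A \<mu>" and mu': "stationary \<beta> \<eta> A \<mu>'"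
    and "0 \<le> \<beta>" "0 \<le> \<eta>" "\<eta> < 1"
  shows "\<mu> = \<mu>'"
proof (rule ccontr)
  assume "\<mu> \<noteq> \<mu>'"
  define f where "f ns = pmf \<mu> ns - pmf \<mu>' ns" for ns
  have f_Nil: "f [] = 0"
    using stationary_pmf_Nil[OF mu] stationary_pmf_Nil[OF mu'] assms by (simp add: f_def)
  obtain ns0 where ns0: "f ns0 \<noteq> 0"
    using \<open>\<mu> \<noteq> \<mu>'\<close> by (metis f_def pmf_eqI eq_iff_diff_eq_0)
  have f_sum: "(f has_sum (measure_pmf.prob \<mu> S - measure_pmf.prob \<mu>' S)) S" for S
    using has_sum_add[OF has_sum_pmf[of \<mu> S] has_sum_cmult_right[OF has_sum_pmf[of \<mu>' S], of "-1"]]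
    by (simp add: f_def[abs_def])
  have f_Cons: "((\<lambda>k. f (k # ns)) has_sum ((\<Sum>\<^sub>\<infinity>k. pmf \<mu> (k # ns)) - (\<Sum>\<^sub>\<infinity>k. pmf \<mu>' (k # ns)))) UNIV" for ns
    using has_sum_add[OF has_sum_pmf_Cons[of \<mu> ns] has_sum_cmult_right[OF has_sum_pmf_Cons[of \<mu>' ns], of "-1"]]
    by (simp add: f_def[abs_def] infsumI[OF has_sum_pmf_Cons])
  have "(\<lambda>ns. \<bar>f ns\<bar>) summable_on UNIV"
    using f_sum[of UNIV] summable_on_iff_abs_summable_on_real[of f UNIV] by (auto simp: summable_on_def)
  then obtain Z where Z: "((\<lambda>ns. \<bar>f ns\<bar>) has_sum Z) UNIV"
    by (auto simp: summable_on_def)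
  have "Z > 0"
  proof (rule ccontr)
    assume "\<not> Z > 0"
    then have "\<bar>f ns0\<bar> = 0"
      using nonneg_has_sum_le_0D[OF Z, of ns0] by simp
    with ns0 show False by simp
  qed
  define R where "R = embed_pmf (\<lambda>ns. \<bar>f ns\<bar> / Z)"
  have R: "pmf R ns = \<bar>f ns\<bar> / Z" for ns
    unfolding R_def using Z \<open>Z > 0\<close> by (intro embed_pmf_has_sum) auto
  have "stationary \<beta> \<eta> A R"
  proof (rule substationary_imp_stationary)
    fix ns
    define a where "a = (if ns = [] then 0 else \<bar>f (butlast ns)\<bar> * pmf A (last ns))"
    have "(\<lambda>k. \<bar>f (k # ns)\<bar>) summable_on UNIV"
      using f_Cons[of ns] summable_on_iff_abs_summable_on_real[of "\<lambda>k. f (k # ns)" UNIV]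
      by (auto simp: summable_on_def)
    then have tl: "\<bar>\<Sum>\<^sub>\<infinity>k. f (k # ns)\<bar> \<le> (\<Sum>\<^sub>\<infinity>k. \<bar>f (k # ns)\<bar>)"
      using norm_infsum_bound[of "\<lambda>k. f (k # ns)" UNIV] by simp
    \<comment> \<open>The equation is linear, so \<open>f\<close> satisfies it too; the void service
      at the empty queue drops out because \<open>f [] = 0\<close>. Absolute values then turn it
      into an inequality for \<open>\<bar>f\<bar>\<close>.\<close>
    have "(\<eta> + 1 + 2 * \<beta>) * f ns = \<eta> * (if ns = [] then 0 else f (butlast ns) * pmf A (last ns))
      + (\<Sum>\<^sub>\<infinity>k. f (k # ns)) + \<beta> * f (translate (-1) ns) + \<beta> * f (translate 1 ns)"
      using mu[unfolded stationary_def, rule_format, of ns] mu'[unfolded stationary_def, rule_format, of ns] f_Nil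
      unfolding pmf_translate pmf_snoc_conv pmf_map_tl infsumI[OF f_Cons]
      by (cases "ns = []") (simp_all add: f_def algebra_simps)
    then have "\<bar>(\<eta> + 1 + 2 * \<beta>) * f ns\<bar> \<le> \<bar>\<eta> * (if ns = [] then 0 else f (butlast ns) * pmf A (last ns))\<bar>
      + (\<Sum>\<^sub>\<infinity>k. \<bar>f (k # ns)\<bar>) + \<bar>\<beta> * f (translate (-1) ns)\<bar> + \<bar>\<beta> * f (translate 1 ns)\<bar>"
      using tl by linarith
    then have le: "(\<eta> + 1 + 2 * \<beta>) * \<bar>f ns\<bar> \<le> \<eta> * a
      + (\<Sum>\<^sub>\<infinity>k. \<bar>f (k # ns)\<bar>) + \<beta> * \<bar>f (translate (-1) ns)\<bar> + \<beta> * \<bar>f (translate 1 ns)\<bar>"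
      using assms by (simp add: abs_mult a_def split: if_splits)
    have "(\<Sum>\<^sub>\<infinity>k. \<bar>f (k # ns)\<bar> / Z) = (\<Sum>\<^sub>\<infinity>k. \<bar>f (k # ns)\<bar>) / Z"
      using infsum_cmult_left'[of "\<lambda>k. \<bar>f (k # ns)\<bar>" "1 / Z" UNIV] by simp
    then show "(\<eta> + 1 + 2 * \<beta>) * pmf R ns \<le>
     \<eta> * pmf (snoc_pmf R A) ns + pmf (map_pmf tl R) ns
     + \<beta> * pmf (map_pmf (translate 1) R) ns + \<beta> * pmf (map_pmf (translate (-1)) R) ns"
      using divide_right_mono[OF le, of Z] \<open>Z > 0\<close> f_Nil
      unfolding pmf_translate pmf_snoc_conv pmf_map_tl R a_def
      by (cases "ns = []") (simp_all add: add_divide_distrib)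
  qed
  then have "pmf R [] = 1 - \<eta>"
    using assms by (intro stationary_pmf_Nil) auto
  with f_Nil assms show False
    by (simp add: R)
qed

section \<open>Construction of the stationary law\<close>

lemma has_sum_power_abs_int:
  fixes r :: real
  assumes "0 \<le> r" "r < 1"
  shows "((\<lambda>k :: int. r ^ nat \<bar>k\<bar>) has_sum ((1 + r) / (1 - r))) UNIV"
proof -
  have "((\<lambda>n. r ^ n) has_sum (1 / (1 - r))) UNIV"
    using assms by (intro sums_nonneg_imp_has_sum geometric_sums) auto
  moreover have "bij_betw int UNIV {0..}"
    by (rule bij_betw_byWitness[where f' = nat]) auto
  from has_sum_reindex_bij_betw[OF this, of "\<lambda>k. r ^ nat \<bar>k\<bar>"]
  have "((\<lambda>n. r ^ n) has_sum s) UNIV = ((\<lambda>k :: int. r ^ nat \<bar>k\<bar>) has_sum s) {0..}" for s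
    by simp
  ultimately have pos: "((\<lambda>k :: int. r ^ nat \<bar>k\<bar>) has_sum (1 / (1 - r))) {0..}"
    by blast
  have "((\<lambda>n. r * r ^ n) has_sum (r * (1 / (1 - r)))) UNIV"
    using assms by (intro sums_nonneg_imp_has_sum sums_mult geometric_sums) auto
  moreover have "bij_betw (\<lambda>n. - int (Suc n)) UNIV {..<0}"
    by (rule bij_betw_byWitness[where f' = "\<lambda>k. nat (- k) - 1"]) auto
  from has_sum_reindex_bij_betw[OF this, of "\<lambda>k. r ^ nat \<bar>k\<bar>"]
  have "((\<lambda>n. r * r ^ n) has_sum s) UNIV = ((\<lambda>k :: int. r ^ nat \<bar>k\<bar>) has_sum s) {..<0}" for s
    by (simp add: nat_add_distrib abs_if)
  ultimately have neg: "((\<lambda>k :: int. r ^ nat \<bar>k\<bar>) has_sum (r * (1 / (1 - r)))) {..<0}"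
    by blast
  have "((\<lambda>k :: int. r ^ nat \<bar>k\<bar>) has_sum (1 / (1 - r) + r * (1 / (1 - r)))) ({0..} \<union> {..<0})"
    using pos neg by (rule has_sum_Un_disjoint) auto
  moreover have "{0..} \<union> {..<0} = (UNIV :: int set)"
    by auto
  ultimately show ?thesis
    by (simp add: add_divide_distrib)
qed

text \<open>In the branches with exponent \<open>nat \<bar>k\<bar> - 1\<close> the integer
  \<open>k\<close> is nonzero, so the subtraction is not truncated.\<close>

lemma power_nat_abs_cases:
  fixes r :: real
  shows "r ^ nat \<bar>k + 1\<bar> = (if k \<ge> 0 then r * r ^ nat \<bar>k\<bar> else r ^ (nat \<bar>k\<bar> - 1))"
    and "r ^ nat \<bar>k - 1\<bar> = (if k \<le> 0 then r * r ^ nat \<bar>k\<bar> else r ^ (nat \<bar>k\<bar> - 1))"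
proof -
  have "nat \<bar>k + 1\<bar> = (if k \<ge> 0 then Suc (nat \<bar>k\<bar>) else nat \<bar>k\<bar> - 1)"
       "nat \<bar>k - 1\<bar> = (if k \<le> 0 then Suc (nat \<bar>k\<bar>) else nat \<bar>k\<bar> - 1)"
    by auto
  then show "r ^ nat \<bar>k + 1\<bar> = (if k \<ge> 0 then r * r ^ nat \<bar>k\<bar> else r ^ (nat \<bar>k\<bar> - 1))"
    "r ^ nat \<bar>k - 1\<bar> = (if k \<le> 0 then r * r ^ nat \<bar>k\<bar> else r ^ (nat \<bar>k\<bar> - 1))"
    by simp_all
qed

text \<open>\<open>G\<close> is the displacement of the random walk over an exponential time of mean 1; it is two-sided
  geometric with ratio \<open>r\<close>, the root in \<open>(0, 1)\<close> of \<open>r = \<beta> (1 - r)\<^sup>2\<close>.\<close>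

lemma exists_resolvent_pmf:
  fixes \<beta> :: real
  assumes "\<beta> > 0"
  shows "\<exists>G. \<forall>j. (1 + 2 * \<beta>) * pmf G j - \<beta> * pmf G (j + 1) - \<beta> * pmf G (j - 1) = of_bool (j = (0::int))"
proof -
  \<comment> \<open>The left side is \<open>- \<beta>\<close> at 0 and 1 at 1.\<close>
  have "\<exists>r\<ge>0. r \<le> 1 \<and> r - \<beta> * (1 - r)\<^sup>2 = 0"
    by (rule IVT') (use assms in \<open>auto intro!: continuous_intros\<close>)
  then obtain r where r: "0 \<le> r" "r \<le> 1" "r - \<beta> * (1 - r)\<^sup>2 = 0"
    by blast
  moreover from r(3) have "r \<noteq> 1"
    by auto
  ultimately have "r < 1" by simp
  define s where "s = (1 + r) / (1 - r)"
  have "s > 0"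
    using r \<open>r < 1\<close> by (simp add: s_def)
  \<comment> \<open>The normalising constant \<open>s\<close> equals the value at
    \<open>j = 0\<close> of the difference operator applied to the unnormalised sequence.\<close>
  have "(1 + 2 * \<beta> - 2 * \<beta> * r) * (1 - r) = 1 + r"
    using r(3) by (simp add: power2_eq_square algebra_simps)
  then have s: "1 + 2 * \<beta> - 2 * \<beta> * r = s"
    using \<open>r < 1\<close> by (simp add: s_def eq_divide_eq)
  define G :: "int pmf" where "G = embed_pmf (\<lambda>k. r ^ nat \<bar>k\<bar> / s)"
  have G: "pmf G k = r ^ nat \<bar>k\<bar> / s" for k
    unfolding G_def using has_sum_power_abs_int[of r] r \<open>r < 1\<close> \<open>s > 0\<close>
    by (intro embed_pmf_has_sum) (auto simp: s_def)
  have "(1 + 2 * \<beta>) * pmf G j - \<beta> * pmf G (j + 1) - \<beta> * pmf G (j - 1) = of_bool (j = 0)" for j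
  proof (cases "j = 0")
    case True
    have "(1 + 2 * \<beta> - 2 * \<beta> * r) / s = 1"
      using s \<open>s > 0\<close> by simp
    with True show ?thesis
      by (simp add: G add_divide_distrib diff_divide_distrib)
  next
    case False
    then obtain n where n: "nat \<bar>j\<bar> = Suc n"
      by (metis not0_implies_Suc nat_eq_iff2 zero_less_abs_iff zero_less_nat_eq less_numeral_extra(3))
    \<comment> \<open>Away from 0 the operator yields a multiple of the equation defining
      \<open>r\<close>.\<close>
    have "(1 + 2 * \<beta>) * (r * r ^ n) - \<beta> * (r * (r * r ^ n)) - \<beta> * r ^ n = r ^ n * (r - \<beta> * (1 - r)\<^sup>2)"
      by (simp add: power2_eq_square algebra_simps)
    then have "(1 + 2 * \<beta>) * (r * r ^ n) - \<beta> * (r * (r * r ^ n)) - \<beta> * r ^ n = 0"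
      using r(3) by simp
    then have "((1 + 2 * \<beta>) * (r * r ^ n) - \<beta> * (r * (r * r ^ n)) - \<beta> * r ^ n) / s = 0"
      by simp
    then have "(1 + 2 * \<beta>) * (r * r ^ n / s) - \<beta> * (r * (r * r ^ n) / s) - \<beta> * (r ^ n / s) = 0"
      by (simp add: add_divide_distrib diff_divide_distrib)
    then show ?thesis
      using False unfolding G power_nat_abs_cases n by (cases "j \<ge> 0") simp_all
  qed
  then show ?thesis by blast
qed

text \<open>Given \<open>l\<close> customers, the times between the successive arrivals of those present, and since the
  last one, are independent exponential of mean 1: each arrival is appended at the end and the
  whole queue is then displaced by an independent \<open>G\<close>-distributed amount.\<close>

primrec queue_law :: "int pmf \<Rightarrow> int pmf \<Rightarrow> nat \<Rightarrow> queue pmf" where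
  "queue_law G A 0 = return_pmf []"
| "queue_law G A (Suc l) = map_pmf (\<lambda>(j, N). translate j N) (pair_pmf G (snoc_pmf (queue_law G A l) A))"

lemma length_queue_law: "N \<in> set_pmf (queue_law G A l) \<Longrightarrow> length N = l"
  by (induction l arbitrary: N) (fastforce simp: snoc_pmf_def)+

lemma map_tl_snoc_pmf:
  assumes "[] \<notin> set_pmf M"
  shows "map_pmf tl (snoc_pmf M A) = snoc_pmf (map_pmf tl M) A"
  unfolding snoc_pmf_def pair_map_pmf1 pmf.map_comp
  using assms by (intro map_pmf_cong) (auto intro: tl_append2)

text \<open>Removing the head commutes with displacements and with appending to a non-empty queue,
  so it passes down to the innermost layer, where a one-customer queue becomes empty.\<close>

lemma map_tl_queue_law: "map_pmf tl (queue_law G A (Suc l)) = queue_law G A l"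
proof (induction l)
  case 0
  have "tl N = []" if "N \<in> set_pmf (queue_law G A (Suc 0))" for N
    using length_queue_law[OF that] by (cases N) auto
  then have "map_pmf tl (queue_law G A (Suc 0)) = map_pmf (\<lambda>_. []) (queue_law G A (Suc 0))"
    by (intro map_pmf_cong refl)
  then show ?case by simp
next
  case (Suc l)
  have "[] \<notin> set_pmf (queue_law G A (Suc l))"
    using length_queue_law by fastforce
  then have "map_pmf tl (snoc_pmf (queue_law G A (Suc l)) A) = snoc_pmf (queue_law G A l) A"
    by (simp only: map_tl_snoc_pmf Suc.IH not_False_eq_True)
  moreover have "map_pmf tl (queue_law G A (Suc (Suc l)))
      = map_pmf (\<lambda>(j, N). translate j N) (pair_pmf G (map_pmf tl (snoc_pmf (queue_law G A (Suc l)) A)))"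
    unfolding queue_law.simps(2)[of G A "Suc l"] pair_map_pmf2 pmf.map_comp
    by (rule map_pmf_cong) (auto simp: map_tl)
  ultimately show ?case
    by simp
qed

text \<open>\<open>M\<close> is a convolution with \<open>G\<close>, so translating the queue
  amounts to shifting the argument of \<open>G\<close>; the equation for \<open>G\<close> then
  collapses the sum to its term at 0.\<close>

lemma resolvent_equation:
  assumes G: "\<And>j. (1 + 2 * \<beta>) * pmf G j - \<beta> * pmf G (j + 1) - \<beta> * pmf G (j - 1) = of_bool (j = (0::int))"
    and M: "M = map_pmf (\<lambda>(j, N). translate j N) (pair_pmf G B)"
  shows "(1 + 2 * \<beta>) * pmf M ns - \<beta> * pmf M (translate (-1) ns) - \<beta> * pmf M (translate 1 ns) = pmf B ns"
proof -
  have sum: "((\<lambda>j. pmf G j * pmf B (translate (-j) ns)) has_sum pmf M ns) UNIV" for ns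
  proof -
    define S where "S = (\<lambda>(j, N). translate j N) -` {ns}"
    have "bij_betw (\<lambda>j. (j, translate (-j) ns)) UNIV S"
      by (rule bij_betw_byWitness[where f' = fst]) (auto simp: S_def o_def)
    then have "((\<lambda>j. pmf (pair_pmf G B) (j, translate (-j) ns)) has_sum measure_pmf.prob (pair_pmf G B) S) UNIV"
      using has_sum_reindex_bij_betw has_sum_pmf by blast
    then show ?thesis
      by (simp add: M pmf_map S_def pmf_pair)
  qed
  have shifted: "((\<lambda>j. pmf G (j - i) * pmf B (translate (-j) ns)) has_sum pmf M (translate (-i) ns)) UNIV" for i
  proof -
    have "bij_betw (\<lambda>j. j - i) UNIV UNIV"
      by (rule bij_betw_byWitness[where f' = "\<lambda>j. j + i"]) auto
    from has_sum_reindex_bij_betw[OF this, of "\<lambda>j. pmf G j * pmf B (translate (-j) (translate (-i) ns))"]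
      sum[of "translate (-i) ns"]
    show ?thesis
      by (simp add: o_def)
  qed
  have "((\<lambda>j. (1 + 2 * \<beta>) * (pmf G j * pmf B (translate (-j) ns))
      + - \<beta> * (pmf G (j - 1) * pmf B (translate (-j) ns))
      + - \<beta> * (pmf G (j - (-1)) * pmf B (translate (-j) ns))) has_sum
      (1 + 2 * \<beta>) * pmf M ns + - \<beta> * pmf M (translate (-1) ns) + - \<beta> * pmf M (translate (- (-1)) ns)) UNIV"
    by (intro has_sum_add has_sum_cmult_right sum shifted)
  also have "(\<lambda>j. (1 + 2 * \<beta>) * (pmf G j * pmf B (translate (-j) ns))
      + - \<beta> * (pmf G (j - 1) * pmf B (translate (-j) ns))
      + - \<beta> * (pmf G (j - (-1)) * pmf B (translate (-j) ns))) =
      (\<lambda>j. ((1 + 2 * \<beta>) * pmf G j - \<beta> * pmf G (j + 1) - \<beta> * pmf G (j - 1)) * pmf B (translate (-j) ns))"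
    by (simp add: algebra_simps)
  finally have "((\<lambda>j. of_bool (j = 0) * pmf B (translate (-j) ns)) has_sum
      (1 + 2 * \<beta>) * pmf M ns + - \<beta> * pmf M (translate (-1) ns) + - \<beta> * pmf M (translate (- (-1)) ns)) UNIV"
    unfolding G .
  moreover have "((\<lambda>j. of_bool (j = 0) * pmf B (translate (-j) ns)) has_sum pmf B ns) UNIV"
    by (rule has_sum_finite_neutralI[where B = "{0}"]) auto
  ultimately have "(1 + 2 * \<beta>) * pmf M ns + - \<beta> * pmf M (translate (-1) ns) + - \<beta> * pmf M (translate (- (-1)) ns)
      = pmf B ns"
    by (rule has_sum_unique)
  then show ?thesis
    by simp
qed

text \<open>The law is the mixture of \<open>queue_law\<close> over a geometric length. By the
  second conjunct the service inflow at a non-empty queue cancels the outflow due to arrivals; what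
  remains is the resolvent equation of one layer. That conjunct also serves to find the law of the
  head.\<close>

lemma stationary_exists:
  assumes "\<beta> > 0" "0 < \<eta>" "\<eta> < 1"
  shows "\<exists>\<mu>. stationary \<beta> \<eta> A \<mu> \<and>
    (\<forall>ns. pmf (map_pmf tl \<mu>) ns = \<eta> * pmf \<mu> ns + (1 - \<eta>) * of_bool (ns = []))"
proof -
  obtain G :: "int pmf" where G: "(1 + 2 * \<beta>) * pmf G j - \<beta> * pmf G (j + 1) - \<beta> * pmf G (j - 1) = of_bool (j = 0)" for j
    using exists_resolvent_pmf[OF assms(1)] by blast
  define \<mu> where "\<mu> = bind_pmf (geometric_pmf (1 - \<eta>)) (queue_law G A)"
  have \<mu>: "pmf \<mu> ns = \<eta> ^ length ns * (1 - \<eta>) * pmf (queue_law G A (length ns)) ns" for ns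
  proof -
    have "pmf (queue_law G A l) ns \<noteq> 0 \<Longrightarrow> l = length ns" for l
      using length_queue_law by (metis set_pmf_iff)
    then have "pmf \<mu> ns = (\<Sum>l\<in>{length ns}. pmf (queue_law G A l) ns * pmf (geometric_pmf (1 - \<eta>)) l)"
      unfolding \<mu>_def pmf_bind by (intro integral_measure_pmf_real) auto
    then show ?thesis
      using assms by simp
  qed
  have tl: "pmf (map_pmf tl \<mu>) ns = \<eta> * pmf \<mu> ns + (1 - \<eta>) * of_bool (ns = [])" for ns
  proof -
    let ?l = "length ns"
    have "pmf (queue_law G A (Suc ?l)) [] = 0"
      using length_queue_law by (metis list.size(3) nat.distinct(1) set_pmf_iff)
    then have "pmf (queue_law G A ?l) ns = (\<Sum>\<^sub>\<infinity>k. pmf (queue_law G A (Suc ?l)) (k # ns))"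
      unfolding map_tl_queue_law[of G A ?l, symmetric] pmf_map_tl by simp
    moreover have "(\<Sum>\<^sub>\<infinity>k. pmf \<mu> (k # ns))
        = \<eta> ^ Suc ?l * (1 - \<eta>) * (\<Sum>\<^sub>\<infinity>k. pmf (queue_law G A (Suc ?l)) (k # ns))"
      unfolding \<mu> list.size(4) add_Suc_right add_0_right by (rule infsum_cmult_right')
    ultimately show ?thesis
      by (simp add: pmf_map_tl \<mu>)
  qed
  have "stationary \<beta> \<eta> A \<mu>"
    unfolding stationary_def
  proof
    fix ns
    show "(\<eta> + 1 + 2 * \<beta>) * pmf \<mu> ns =
     \<eta> * pmf (snoc_pmf \<mu> A) ns + pmf (map_pmf tl \<mu>) ns
     + \<beta> * pmf (map_pmf (translate 1) \<mu>) ns + \<beta> * pmf (map_pmf (translate (-1)) \<mu>) ns"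
    proof (cases ns rule: rev_cases)
      case Nil
      then show ?thesis
        unfolding tl pmf_translate by (simp add: \<mu> algebra_simps)
    next
      case (snoc N x)
      let ?M = "queue_law G A (Suc (length N))"
      let ?c = "\<eta> ^ Suc (length N) * (1 - \<eta>)"
      \<comment> \<open>Translates of \<open>ns\<close> have the same length, hence the same
        component and weight.\<close>
      have M: "pmf \<mu> ms = ?c * pmf ?M ms" if "length ms = Suc (length N)" for ms
        by (simp only: \<mu> that)
      have m: "pmf \<mu> ns = ?c * pmf ?M ns" "pmf \<mu> (translate (-1) ns) = ?c * pmf ?M (translate (-1) ns)"
        "pmf \<mu> (translate 1 ns) = ?c * pmf ?M (translate 1 ns)"
        by (rule M, simp add: snoc)+
      have "(1 + 2 * \<beta>) * pmf ?M ns - \<beta> * pmf ?M (translate (-1) ns) - \<beta> * pmf ?M (translate 1 ns)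
          = pmf (snoc_pmf (queue_law G A (length N)) A) ns"
        by (rule resolvent_equation[OF G]) simp
      then have "?c * ((1 + 2 * \<beta>) * pmf ?M ns - \<beta> * pmf ?M (translate (-1) ns) - \<beta> * pmf ?M (translate 1 ns))
          = \<eta> * pmf (snoc_pmf \<mu> A) ns"
        by (simp add: snoc \<mu>)
      moreover have "?c * ((1 + 2 * \<beta>) * pmf ?M ns - \<beta> * pmf ?M (translate (-1) ns) - \<beta> * pmf ?M (translate 1 ns))
          = (1 + 2 * \<beta>) * (?c * pmf ?M ns) - \<beta> * (?c * pmf ?M (translate (-1) ns))
            - \<beta> * (?c * pmf ?M (translate 1 ns))"
        by (simp only: algebra_simps)
      ultimately have "(1 + 2 * \<beta>) * pmf \<mu> ns - \<beta> * pmf \<mu> (translate (-1) ns) - \<beta> * pmf \<mu> (translate 1 ns)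
          = \<eta> * pmf (snoc_pmf \<mu> A) ns"
        unfolding m by linarith
      moreover have "ns \<noteq> []"
        using snoc by simp
      ultimately show ?thesis
        unfolding tl pmf_translate by (simp add: algebra_simps)
    qed
  qed
  with tl show ?thesis by blast
qed

section \<open>Law of the head and its self-consistent form\<close>

text \<open>By uniqueness \<mu> is the constructed law, so after a service the head has its old law
  times \<eta>. Summing the balance over the queues with head \<open>k\<close> then closes up in
  \<open>head_prob\<close>.\<close>

lemma head_prob_equation:
  assumes mu: "stationary \<beta> \<eta> A \<mu>" and "\<beta> > 0" "0 < \<eta>" "\<eta> < 1"
  shows "(1 - \<eta> + 2 * \<beta>) * head_prob \<mu> k - \<beta> * head_prob \<mu> (k + 1) - \<beta> * head_prob \<mu> (k - 1)
    = (1 - \<eta>) * (\<eta> * pmf A k)"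
proof -
  obtain \<mu>' where "stationary \<beta> \<eta> A \<mu>'"
    and "\<And>ns. pmf (map_pmf tl \<mu>') ns = \<eta> * pmf \<mu>' ns + (1 - \<eta>) * of_bool (ns = [])"
    using stationary_exists assms by blast
  moreover from this(1) have "\<mu>' = \<mu>"
    using stationary_unique mu assms by (meson less_imp_le)
  ultimately have tl: "pmf (map_pmf tl \<mu>) ns = \<eta> * pmf \<mu> ns" if "ns \<noteq> []" for ns
    using that by simp
  define S where "S k = {N :: queue. N \<noteq> [] \<and> hd N = k}" for k
  have head: "head_prob \<mu> j = measure_pmf.prob \<mu> (S j)" for j
    by (simp add: head_prob_def S_def)
  have "((\<lambda>ns. \<eta> * pmf \<mu> ns) has_sum \<eta> * head_prob \<mu> k) (S k)"
    unfolding head by (intro has_sum_cmult_right has_sum_pmf)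
  then have "(pmf (map_pmf tl \<mu>) has_sum \<eta> * head_prob \<mu> k) (S k)"
    by (rule has_sum_cong[THEN iffD1, rotated]) (simp add: tl S_def)
  then have prob_tl: "measure_pmf.prob \<mu> (tl -` S k) = \<eta> * head_prob \<mu> k"
    using has_sum_unique[OF has_sum_pmf[of "map_pmf tl \<mu>" "S k"]] by simp
  have trans: "translate 1 -` S k = S (k - 1)" "translate (-1) -` S k = S (k + 1)"
    by (auto simp: S_def hd_map)
  \<comment> \<open>An arrival becomes the head only at an empty queue, which has probability
    \<open>1 - \<eta>\<close>.\<close>
  have "(\<lambda>(N, x). N @ [x]) -` S k = S k \<times> UNIV \<union> {[]} \<times> {k}"
    by (auto simp: S_def hd_append split: if_splits)
  then have "measure_pmf.prob (snoc_pmf \<mu> A) (S k) = measure_pmf.prob (pair_pmf \<mu> A) (S k \<times> UNIV \<union> {[]} \<times> {k})"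
    by (simp add: snoc_pmf_def)
  also have "\<dots> = measure_pmf.prob (pair_pmf \<mu> A) (S k \<times> UNIV) + measure_pmf.prob (pair_pmf \<mu> A) ({[]} \<times> {k})"
    by (rule measure_pmf.finite_measure_Union) (auto simp: S_def)
  also have "\<dots> = head_prob \<mu> k + (1 - \<eta>) * pmf A k"
    using stationary_pmf_Nil[OF mu] assms
    by (simp add: measure_pmf_prob_product head measure_pmf_single pmf_pair measure_pmf.prob_space[simplified])
  finally have "(\<eta> + 1 + 2 * \<beta>) * head_prob \<mu> k = \<eta> * (head_prob \<mu> k + (1 - \<eta>) * pmf A k) + \<eta> * head_prob \<mu> k
    + \<beta> * head_prob \<mu> (k - 1) + \<beta> * head_prob \<mu> (k + 1)"
    using stationary_prob[OF mu, of "S k"] unfolding prob_tl trans head by simp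
  then show ?thesis
    by (simp add: algebra_simps)
qed

lemma geometric_solution:
  fixes x :: "nat \<Rightarrow> real"
  assumes "\<beta> > 0" "\<eta> < 1" and lim: "x \<longlonglongrightarrow> 0"
    and rec: "\<And>n. (1 - \<eta> + 2 * \<beta>) * x (Suc n) - \<beta> * x (Suc (Suc n)) - \<beta> * x n = (1 - \<eta>) * x (Suc (Suc n))"
  shows "x n = x 0 * (\<beta> / (\<beta> + 1 - \<eta>)) ^ n"
proof -
  define q where "q = \<beta> / (\<beta> + 1 - \<eta>)"
  have q: "(\<beta> + 1 - \<eta>) * q = \<beta>"
    using assms by (simp add: q_def)
  \<comment> \<open>The characteristic roots are 1 and \<open>q\<close>. Removing the root
    \<open>q\<close> leaves a constant sequence, which must be 0 because \<open>x\<close> tends to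
    0.\<close>
  define w where "w n = x (Suc n) - q * x n" for n
  have w: "w n = w 0" for n
  proof (induction n)
    case (Suc n)
    have "(\<beta> + 1 - \<eta>) * w (Suc n) = (\<beta> + 1 - \<eta>) * x (Suc (Suc n)) - (\<beta> + 1 - \<eta>) * q * x (Suc n)"
      by (simp add: w_def algebra_simps)
    also have "\<dots> = (\<beta> + 1 - \<eta>) * x (Suc n) - (\<beta> + 1 - \<eta>) * q * x n"
      unfolding q using rec[of n] by (simp add: algebra_simps)
    also have "\<dots> = (\<beta> + 1 - \<eta>) * w n"
      by (simp add: w_def algebra_simps)
    finally show ?case
      using Suc assms by simp
  qed simp
  have "(\<lambda>n. x (Suc n) - q * x n) \<longlonglongrightarrow> 0 - q * 0"
    by (intro tendsto_intros lim LIMSEQ_Suc)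
  then have "w \<longlonglongrightarrow> 0"
    by (simp add: w_def[abs_def])
  also have "w = (\<lambda>n. w 0)"
    by (rule ext) (rule w)
  finally have "(\<lambda>n. w 0) \<longlonglongrightarrow> 0" .
  then have "w 0 = 0"
    by (simp add: LIMSEQ_const_iff)
  then have x_Suc: "x (Suc n) = q * x n" for n
    using w[of n] by (simp add: w_def)
  show ?thesis
    unfolding q_def[symmetric] by (induction n) (simp_all add: x_Suc)
qed

text \<open>The head of the queue turns out to be at distance \<open>k\<close> with probability \<open>exit_law \<beta> \<eta> k\<close>
  (total mass \<open>\<eta>\<close>, the rest being the empty queue). The ratio is the root other than 1 of
  \<open>\<beta> (z - 1)\<^sup>2 + (1 - \<eta>) z (z - 1) = 0\<close>.\<close>

definition exit_law :: "real \<Rightarrow> real \<Rightarrow> int \<Rightarrow> real" where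
  "exit_law \<beta> \<eta> k = (let q = \<beta> / (\<beta> + 1 - \<eta>) in \<eta> * (1 - q) / (1 + q) * q ^ nat \<bar>k\<bar>)"

text \<open>Arrival rates when departures occur at rates \<open>d\<close>: a customer served at distance at least 2
  moves one step closer, the others leave and are replaced by the exogenous flow at 0.\<close>

definition flow :: "(int \<Rightarrow> real) \<Rightarrow> int \<Rightarrow> real" where
  "flow d k = (if k > 0 then d (k + 1) else if k < 0 then d (k - 1) else d (-1) + d 0 + d 1)"

lemma has_sum_int_translate:
  fixes f :: "int \<Rightarrow> real"
  assumes "(f has_sum s) UNIV"
  shows "((\<lambda>k. f (k + i)) has_sum s) UNIV"
proof -
  have "bij_betw (\<lambda>k. k + i) UNIV UNIV"
    by (rule bij_betw_byWitness[where f' = "\<lambda>k. k - i"]) auto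
  from has_sum_reindex_bij_betw[OF this, of f] assms show ?thesis by blast
qed

context
  fixes \<beta> \<eta> :: real
  assumes beta: "\<beta> > 0" and eta: "0 < \<eta>" "\<eta> < 1"
begin

lemma ratio_bounds: "0 < \<beta> / (\<beta> + 1 - \<eta>)" "\<beta> / (\<beta> + 1 - \<eta>) < 1"
  using beta eta by auto

lemma exit_law_pos: "exit_law \<beta> \<eta> k > 0"
  using ratio_bounds eta unfolding exit_law_def Let_def
  by (intro mult_pos_pos divide_pos_pos) auto

lemma has_sum_exit_law: "(exit_law \<beta> \<eta> has_sum \<eta>) UNIV"
proof -
  define q where "q = \<beta> / (\<beta> + 1 - \<eta>)"
  have q: "0 < q" "q < 1"
    using ratio_bounds by (auto simp: q_def)
  have "((\<lambda>k. \<eta> * (1 - q) / (1 + q) * q ^ nat \<bar>k\<bar>) has_sum (\<eta> * (1 - q) / (1 + q) * ((1 + q) / (1 - q)))) UNIV"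
    using q by (intro has_sum_cmult_right has_sum_power_abs_int) auto
  moreover have "\<eta> * (1 - q) / (1 + q) * ((1 + q) / (1 - q)) = \<eta>"
    using q by simp
  ultimately show ?thesis
    by (simp add: exit_law_def[abs_def] q_def Let_def)
qed

text \<open>Both at 0 and away from it, the equation reduces to
  \<open>(1 - \<eta>) * q = \<beta> * (1 - q)\<close>.\<close>

lemma exit_law_equation:
  "(1 - \<eta> + 2 * \<beta>) * exit_law \<beta> \<eta> k - \<beta> * exit_law \<beta> \<eta> (k + 1) - \<beta> * exit_law \<beta> \<eta> (k - 1)
    = (1 - \<eta>) * flow (exit_law \<beta> \<eta>) k"
proof -
  define q where "q = \<beta> / (\<beta> + 1 - \<eta>)"
  define c where "c = \<eta> * (1 - q) / (1 + q)"
  have d: "exit_law \<beta> \<eta> k = c * q ^ nat \<bar>k\<bar>" for k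
    by (simp add: exit_law_def c_def q_def Let_def)
  have "(\<beta> + 1 - \<eta>) * q = \<beta>"
    using beta eta by (simp add: q_def)
  then have q: "q - \<eta> * q = \<beta> - \<beta> * q"
    by (simp add: algebra_simps)
  then have qq: "y * q - \<eta> * q * y = \<beta> * y - \<beta> * q * y" for y
    using arg_cong[OF q, of "\<lambda>z. z * y"] by (simp add: algebra_simps)
  show ?thesis
  proof (cases "k = 0")
    case True
    have "(1 - \<eta> + 2 * \<beta>) - \<beta> * q - \<beta> * q = (1 - \<eta>) * (q + 1 + q)"
      using q by (simp add: algebra_simps)
    then have "c * ((1 - \<eta> + 2 * \<beta>) - \<beta> * q - \<beta> * q) = c * ((1 - \<eta>) * (q + 1 + q))"
      by simp
    with True show ?thesis
      by (simp add: d flow_def algebra_simps)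
  next
    case False
    then obtain n where n: "nat \<bar>k\<bar> = Suc n"
      by (metis not0_implies_Suc nat_eq_iff2 zero_less_abs_iff zero_less_nat_eq less_numeral_extra(3))
    have "(1 - \<eta> + 2 * \<beta>) * q - \<beta> * (q * q) - \<beta> = (1 - \<eta>) * (q * q)"
      using q qq[of q] by (simp add: algebra_simps)
    then have "c * q ^ n * ((1 - \<eta> + 2 * \<beta>) * q - \<beta> * (q * q) - \<beta>) = c * q ^ n * ((1 - \<eta>) * (q * q))"
      by (rule arg_cong)
    then have "(1 - \<eta> + 2 * \<beta>) * (c * (q * q ^ n)) - \<beta> * (c * (q * (q * q ^ n))) - \<beta> * (c * q ^ n)
        = (1 - \<eta>) * (c * (q * (q * q ^ n)))"
      by (simp add: algebra_simps)
    then show ?thesis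
      using False unfolding d flow_def power_nat_abs_cases n by (cases "k \<ge> 0") (simp_all add: algebra_simps)
  qed
qed

text \<open>Summing \<open>exit_law_equation\<close> over all \<open>k\<close>, the second
  differences cancel. Hence \<open>flow\<close> divided by \<eta> is a probability law.\<close>

lemma has_sum_flow: "(flow (exit_law \<beta> \<eta>) has_sum \<eta>) UNIV"
proof -
  have "((\<lambda>k. 1 / (1 - \<eta>) * ((1 - \<eta> + 2 * \<beta>) * exit_law \<beta> \<eta> k + - \<beta> * exit_law \<beta> \<eta> (k + 1)
      + - \<beta> * exit_law \<beta> \<eta> (k + (-1)))) has_sum
      1 / (1 - \<eta>) * ((1 - \<eta> + 2 * \<beta>) * \<eta> + - \<beta> * \<eta> + - \<beta> * \<eta>)) UNIV"
    by (intro has_sum_cmult_right has_sum_add has_sum_int_translate has_sum_exit_law)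
  moreover have "1 / (1 - \<eta>) * ((1 - \<eta> + 2 * \<beta>) * \<eta> + - \<beta> * \<eta> + - \<beta> * \<eta>) = \<eta>"
    using eta by (simp add: field_simps)
  moreover have "1 / (1 - \<eta>) * ((1 - \<eta> + 2 * \<beta>) * exit_law \<beta> \<eta> k + - \<beta> * exit_law \<beta> \<eta> (k + 1)
      + - \<beta> * exit_law \<beta> \<eta> (k + (-1))) = flow (exit_law \<beta> \<eta>) k" for k
    using exit_law_equation[of k] eta by simp
  ultimately show ?thesis
    by simp
qed

text \<open>Summability forces decay on each half-line, so both halves are geometric with common
  value \<open>d 0\<close>, which the total mass fixes. The equation is asked only for
  \<open>k \<noteq> 0\<close>, since the arrival rate at 0 contains the still unknown exogenous
  flow.\<close>

lemma exit_law_unique: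
  assumes sum: "(d has_sum \<eta>) UNIV"
    and eq: "\<And>k. k \<noteq> 0 \<Longrightarrow> (1 - \<eta> + 2 * \<beta>) * d k - \<beta> * d (k + 1) - \<beta> * d (k - 1) = (1 - \<eta>) * flow d k"
  shows "d = exit_law \<beta> \<eta>"
proof -
  define q where "q = \<beta> / (\<beta> + 1 - \<eta>)"
  have lim: "(\<lambda>n. d (i * int n)) \<longlonglongrightarrow> 0" if "i = 1 \<or> i = -1" for i
  proof -
    have "inj (\<lambda>n. i * int n)"
      using that by (auto simp: inj_on_def)
    moreover have "d summable_on range (\<lambda>n. i * int n)"
      using sum summable_on_subset_banach[of d UNIV] by (auto simp: summable_on_def)
    ultimately have "(\<lambda>n. d (i * int n)) summable_on UNIV"
      by (simp add: summable_on_reindex o_def)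
    then show ?thesis
      by (meson has_sum_imp_sums summable_LIMSEQ_zero summable_on_def sums_summable)
  qed
  have pos: "d (1 * int n) = d (1 * int 0) * q ^ n" for n
    unfolding q_def
    by (rule geometric_solution[OF beta eta(2) lim]) (use eq[of "int (Suc n)" for n] in \<open>simp_all add: flow_def algebra_simps\<close>)
  have neg: "d (-1 * int n) = d (-1 * int 0) * q ^ n" for n
    unfolding q_def
    by (rule geometric_solution[OF beta eta(2) lim]) (use eq[of "- int (Suc n)" for n] in \<open>simp_all add: flow_def algebra_simps\<close>)
  have d: "d k = d 0 * q ^ nat \<bar>k\<bar>" for k
    using pos[of "nat k"] neg[of "nat (-k)"] by (cases "k \<ge> 0") auto
  have q: "0 < q" "q < 1"
    using ratio_bounds by (auto simp: q_def)
  have "((\<lambda>k. d 0 * q ^ nat \<bar>k\<bar>) has_sum (d 0 * ((1 + q) / (1 - q)))) UNIV"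
    using q by (intro has_sum_cmult_right has_sum_power_abs_int) auto
  then have "(d has_sum (d 0 * ((1 + q) / (1 - q)))) UNIV"
    by (rule has_sum_cong[THEN iffD1, rotated]) (rule d[symmetric])
  then have "d 0 * ((1 + q) / (1 - q)) = \<eta>"
    using sum by (rule has_sum_unique)
  then have "d 0 = \<eta> * (1 - q) / (1 + q)"
    using q by (auto simp: field_simps)
  then have "d k = exit_law \<beta> \<eta> k" for k
    using d[of k] by (simp add: exit_law_def Let_def q_def)
  then show ?thesis by auto
qed

text \<open>The difference \<open>e\<close> has
  \<open>(1 - \<eta> + 2 * \<beta>) * \<bar>e k\<bar>\<close> at most \<beta> times the sum over its
  two neighbours; summing over \<open>k\<close> gives
  \<open>(1 - \<eta>) * Z \<le> 0\<close>.\<close>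

lemma head_equation_unique:
  assumes sum: "(d has_sum s) UNIV" "(d' has_sum s') UNIV"
    and eq: "\<And>k. (1 - \<eta> + 2 * \<beta>) * d k - \<beta> * d (k + 1) - \<beta> * d (k - 1)
      = (1 - \<eta> + 2 * \<beta>) * d' k - \<beta> * d' (k + 1) - \<beta> * d' (k - 1)"
  shows "d = (d' :: int \<Rightarrow> real)"
proof
  fix k
  define e where "e k = d k - d' k" for k
  have "((\<lambda>k. d k + - 1 * d' k) has_sum s + - 1 * s') UNIV"
    by (intro has_sum_add has_sum_cmult_right sum)
  then have "e summable_on UNIV"
    by (auto simp: summable_on_def e_def[abs_def])
  then obtain Z where Z: "((\<lambda>k. \<bar>e k\<bar>) has_sum Z) UNIV"
    using summable_on_iff_abs_summable_on_real[of e UNIV] by (auto simp: summable_on_def)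
  have "(1 - \<eta> + 2 * \<beta>) * \<bar>e k\<bar> \<le> \<beta> * \<bar>e (k + 1)\<bar> + \<beta> * \<bar>e (k + (-1))\<bar>" for k
  proof -
    have "(1 - \<eta> + 2 * \<beta>) * e k = \<beta> * e (k + 1) + \<beta> * e (k - 1)"
      using eq[of k] by (simp add: e_def algebra_simps)
    then have "\<bar>(1 - \<eta> + 2 * \<beta>) * e k\<bar> \<le> \<bar>\<beta> * e (k + 1)\<bar> + \<bar>\<beta> * e (k - 1)\<bar>"
      by linarith
    then show ?thesis
      using beta eta by (simp add: abs_mult)
  qed
  then have "(1 - \<eta> + 2 * \<beta>) * Z \<le> \<beta> * Z + \<beta> * Z"
    by (rule has_sum_mono[OF has_sum_cmult_right[OF Z] has_sum_add[OF
          has_sum_cmult_right[OF has_sum_int_translate[OF Z]] has_sum_cmult_right[OF has_sum_int_translate[OF Z]]]])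
  then have "(1 - \<eta>) * Z \<le> 0"
    by (simp add: algebra_simps)
  then have "Z \<le> 0"
    using eta by (simp add: mult_le_0_iff)
  then have "\<bar>e k\<bar> = 0"
    using nonneg_has_sum_le_0D[OF Z] by simp
  then show "d k = d' k"
    by (simp add: e_def)
qed

section \<open>Existence and uniqueness of the solution\<close>

text \<open>With arrival rates \<open>flow ?d\<close>, the head law solves the same equation as
  \<open>?d\<close> and so equals it; the rates it produces are then the assumed ones, and the
  exogenous flow is the rate at 0.\<close>

lemma solution_exists:
  "\<exists>\<mu>. symmetric_rates \<mu> \<and> balance \<beta> (flow (exit_law \<beta> \<eta>) 0) \<mu>
    \<and> total_rate (flow (exit_law \<beta> \<eta>) 0) \<mu> = \<eta>"
proof -
  let ?d = "exit_law \<beta> \<eta>"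
  define A where "A = embed_pmf (\<lambda>k. flow ?d k / \<eta>)"
  have "flow ?d k \<ge> 0" for k
    using exit_law_pos by (simp add: flow_def add_nonneg_nonneg less_imp_le)
  then have A: "\<eta> * pmf A k = flow ?d k" for k
    using embed_pmf_has_sum[OF has_sum_flow] eta by (simp add: A_def)
  obtain \<mu> where mu: "stationary \<beta> \<eta> A \<mu>"
    using stationary_exists[OF beta eta] by blast
  have "head_prob \<mu> = ?d"
    using has_sum_head_prob has_sum_exit_law
    by (rule head_equation_unique)
      (simp only: head_prob_equation[OF mu beta eta] exit_law_equation A)
  then have rate: "node_rate \<mu> k = (if k = 0 then 0 else flow ?d k)" for k
    by (simp add: node_rate_conv flow_def)
  have "(flow ?d has_sum (\<eta> - flow ?d 0)) (UNIV - {0})"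
    using has_sum_Diff[OF has_sum_flow has_sum_finite[of "{0}"]] by simp
  then have "(node_rate \<mu> has_sum (\<eta> - flow ?d 0)) (- {0})"
    unfolding Compl_eq_Diff_UNIV by (rule has_sum_cong[THEN iffD1, rotated]) (simp add: rate)
  then have "transit_rate \<mu> = \<eta> - flow ?d 0"
    unfolding transit_rate_def by (rule infsumI)
  then have total: "total_rate (flow ?d 0) \<mu> = \<eta>"
    by (simp add: total_rate_def)
  moreover have "symmetric_rates \<mu>"
    unfolding symmetric_rates_def
  proof
    fix k
    have "?d (- (k + 1)) = ?d (k + 1)" "?d (- (k - 1)) = ?d (k - 1)"
      unfolding exit_law_def abs_minus_cancel by (rule refl)+
    then show "node_rate \<mu> k = node_rate \<mu> (- k)"
      by (simp add: rate flow_def)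
  qed
  moreover have "balance \<beta> (flow ?d 0) \<mu>"
    using balance_iff_stationary[OF total, of A] mu by (simp add: rate A)
  ultimately show ?thesis by blast
qed

text \<open>Any solution is stationary for one explicit arrival law, which brings
  \<open>stationary_unique\<close> within reach.\<close>

lemma solution_unique:
  assumes "lam \<ge> 0" and bal: "balance \<beta> lam \<mu>" and total: "total_rate lam \<mu> = \<eta>"
  shows "lam = flow (exit_law \<beta> \<eta>) 0"
    and "stationary \<beta> \<eta> (embed_pmf (\<lambda>k. flow (exit_law \<beta> \<eta>) k / \<eta>)) \<mu>"
proof -
  define a where "a k = node_rate \<mu> k + lam * of_bool (k = 0)" for k
  have a_nonneg: "a k \<ge> 0" for k
    using assms(1) head_prob_nonneg by (simp add: a_def node_rate_conv)
  \<comment> \<open>Two shifted copies of \<open>head_prob\<close> dominate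
    \<open>node_rate\<close>, so \<open>transit_rate\<close> is a true sum and not the default 0 of
    \<open>infsum\<close>.\<close>
  have "((\<lambda>k. head_prob \<mu> (k + 1) + head_prob \<mu> (k + (-1))) has_sum
      (1 - pmf \<mu> []) + (1 - pmf \<mu> [])) UNIV"
    by (intro has_sum_add has_sum_int_translate has_sum_head_prob)
  then have "(\<lambda>k. head_prob \<mu> (k + 1) + head_prob \<mu> (k + (-1))) summable_on - {0}"
    using summable_on_subset_banach summable_on_def by blast
  then have "node_rate \<mu> summable_on - {0}"
    by (rule summable_on_comparison_test) (auto simp: node_rate_conv head_prob_nonneg)
  then have "(node_rate \<mu> has_sum transit_rate \<mu>) (- {0})"
    unfolding transit_rate_def by simp
  then have "(a has_sum transit_rate \<mu>) (- {0})"
    by (rule has_sum_cong[THEN iffD1, rotated]) (simp add: a_def)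
  then have "(a has_sum (transit_rate \<mu> + a 0)) (- {0} \<union> {0})"
    using has_sum_Un_disjoint[OF _ has_sum_finite[of "{0}" a]] by simp
  moreover have "- {0} \<union> {0} = (UNIV :: int set)"
    by auto
  moreover have "a 0 = lam"
    by (simp add: a_def node_rate_conv)
  ultimately have a_sum: "(a has_sum \<eta>) UNIV"
    using total by (simp add: total_rate_def)
  define A where "A = embed_pmf (\<lambda>k. a k / \<eta>)"
  have A: "\<eta> * pmf A k = a k" for k
    using embed_pmf_has_sum[OF a_sum a_nonneg eta(1)] eta by (simp add: A_def)
  have mu: "stationary \<beta> \<eta> A \<mu>"
    using balance_iff_stationary[OF total, of A] bal by (simp add: A a_def)
  note head = head_prob_equation[OF mu beta eta, unfolded A]
  have "head_prob \<mu> = exit_law \<beta> \<eta>"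
  proof (rule exit_law_unique)
    show "(head_prob \<mu> has_sum \<eta>) UNIV"
      using has_sum_head_prob[of \<mu>] stationary_pmf_Nil[OF mu] eta by simp
    show "(1 - \<eta> + 2 * \<beta>) * head_prob \<mu> k - \<beta> * head_prob \<mu> (k + 1) - \<beta> * head_prob \<mu> (k - 1)
        = (1 - \<eta>) * flow (head_prob \<mu>) k" if "k \<noteq> 0" for k
      unfolding head using that by (simp add: a_def node_rate_conv flow_def)
  qed
  \<comment> \<open>With the head law known, its equation returns the arrival rates at every
    \<open>k\<close>; the case \<open>k = 0\<close> yields \<open>lam\<close>.\<close>
  then have "(1 - \<eta>) * a k = (1 - \<eta>) * flow (exit_law \<beta> \<eta>) k" for k
    by (metis exit_law_equation head)
  then have "a = flow (exit_law \<beta> \<eta>)"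
    using eta by auto
  then show "lam = flow (exit_law \<beta> \<eta>) 0"
    "stationary \<beta> \<eta> (embed_pmf (\<lambda>k. flow (exit_law \<beta> \<eta>) k / \<eta>)) \<mu>"
    using \<open>a 0 = lam\<close> mu by (auto simp: A_def)
qed

end

theorem theorem15:
  fixes \<beta> \<eta> :: real
  assumes "\<beta> > 0" and "0 < \<eta>" and "\<eta> < 1"
  shows "\<exists>!p :: real \<times> queue pmf. case p of (lam, \<mu>) \<Rightarrow>
           lam \<ge> 0 \<and> symmetric_rates \<mu> \<and> balance \<beta> lam \<mu> \<and> total_rate lam \<mu> = \<eta>"
proof -
  obtain \<mu> where mu: "symmetric_rates \<mu>" "balance \<beta> (flow (exit_law \<beta> \<eta>) 0) \<mu>"
    "total_rate (flow (exit_law \<beta> \<eta>) 0) \<mu> = \<eta>"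
    using solution_exists[OF assms] by blast
  have lam: "flow (exit_law \<beta> \<eta>) 0 \<ge> 0"
    using exit_law_pos[OF assms] by (simp add: flow_def add_nonneg_nonneg less_imp_le)
  show ?thesis
  proof (rule ex1I[of _ "(flow (exit_law \<beta> \<eta>) 0, \<mu>)"])
    show "case (flow (exit_law \<beta> \<eta>) 0, \<mu>) of (lam, \<mu>) \<Rightarrow>
           lam \<ge> 0 \<and> symmetric_rates \<mu> \<and> balance \<beta> lam \<mu> \<and> total_rate lam \<mu> = \<eta>"
      using mu lam by simp
  next
    fix p :: "real \<times> queue pmf"
    assume p: "case p of (lam, \<mu>) \<Rightarrow>
           lam \<ge> 0 \<and> symmetric_rates \<mu> \<and> balance \<beta> lam \<mu> \<and> total_rate lam \<mu> = \<eta>"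
    obtain lam' \<mu>' where p_eq: "p = (lam', \<mu>')"
      by (cases p)
    with p have "lam' = flow (exit_law \<beta> \<eta>) 0"
      and "stationary \<beta> \<eta> (embed_pmf (\<lambda>k. flow (exit_law \<beta> \<eta>) k / \<eta>)) \<mu>'"
      using solution_unique[OF assms, of lam' \<mu>'] by auto
    moreover have "stationary \<beta> \<eta> (embed_pmf (\<lambda>k. flow (exit_law \<beta> \<eta>) k / \<eta>)) \<mu>"
      using solution_unique(2)[OF assms lam mu(2,3)] .
    ultimately show "p = (flow (exit_law \<beta> \<eta>) 0, \<mu>)"
      using p_eq assms by (auto intro: stationary_unique)
  qed
qed

end
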